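(* Let $X$ be a Banach space and let $C$ be a nonempty closed subset of $X$. Let $f,g:C\to C$ be two continuous functions such that $$\phi(\|f(x)-g(y)\|)\leq \psi(\|x-f(x)\|,\|y-g(y)\|)-\phi_1(\|x-y\|)\quad\text{for all }x,y\in C,$$ where (i) $\phi,\phi_1:[0,\infty)\to[0,\infty)$ are two altering distance functions; (ii) $\psi:[0,\infty)\times[0,\infty)\to[0,\infty)$ is a function such that $\psi$ is continuous at $(0,0)$, $\psi(0,0)=0$, and for all $t_1,t_2\in[0,\infty)$ with $t_1>0$ or $t_2>0$ (or both), one has $\psi(t_1,t_2)<\phi(t_1)$ or $\psi(t_1,t_2)<\phi(t_2)$. Then $f$ and $g$ have a unique common fixed point, i.e. there is exactly one $z\in C$ with $f(z)=z=g(z)$.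
   Context: A function $\varphi:[0,\infty)\to[0,\infty)$ is called an altering distance function if (i) $\varphi$ is monotone increasing (in the sense $s\le t\Rightarrow\varphi(s)\le\varphi(t)$) and continuous, and (ii) $\varphi(t)=0$ if and only if $t=0$. *)

theory Defs
  imports "HOL-Analysis.Analysis"
begin

text \<open>A function on \<open>[0,\<infinity>)\<close> is represented by a total function on the reals
  that is constrained on \<open>{0..}\<close> only; its values at negative arguments are irrelevant.\<close>

definition altering_distance :: "(real \<Rightarrow> real) \<Rightarrow> bool" where
  "altering_distance \<phi> \<longleftrightarrow>
     \<phi> \<in> {0..} \<rightarrow> {0..} \<and>
     mono_on {0..} \<phi> \<and>
     continuous_on {0..} \<phi> \<and>
     (\<forall>t\<ge>0. \<phi> t = 0 \<longleftrightarrow> t = 0)"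

end

theory Submission
  imports Defs
begin

text \<open>Iterate \<open>f\<close> and \<open>g\<close> alternately. Condition (ii) forces \<open>\<phi>(d\<^sub>n\<^sub>+\<^sub>1) + \<phi>\<^sub>1(d\<^sub>n) \<le> \<phi>(d\<^sub>n)\<close> for the
  step lengths \<open>d\<^sub>n\<close>, so \<open>d\<^sub>n \<longlonglongrightarrow> 0\<close>. Dropping the left-hand side of the contraction instead
  gives \<open>\<phi>\<^sub>1(\<parallel>x\<^sub>p - x\<^sub>q\<parallel>) \<le> \<psi>(d\<^sub>p, d\<^sub>q)\<close> for even \<open>p\<close> and odd \<open>q\<close>; as \<open>\<psi>\<close> is continuous at the
  origin, the orbit is Cauchy, and by continuity its limit is fixed by both maps.\<close>

lemma altering_distance_nonneg: "altering_distance \<phi> \<Longrightarrow> t \<ge> 0 \<Longrightarrow> \<phi> t \<ge> 0"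
  by (auto simp: altering_distance_def)

lemma altering_distance_0: "altering_distance \<phi> \<Longrightarrow> \<phi> 0 = 0"
  unfolding altering_distance_def by blast

lemma altering_distance_pos: "altering_distance \<phi> \<Longrightarrow> t > 0 \<Longrightarrow> \<phi> t > 0"
  unfolding altering_distance_def
  by (metis Pi_iff atLeast_iff less_eq_real_def less_irrefl)

lemma altering_distance_less_imp_less:
  assumes "altering_distance \<phi>" "s \<ge> 0" "\<phi> t < \<phi> s"
  shows "t < s"
proof (rule ccontr)
  assume "\<not> t < s"
  then have "\<phi> s \<le> \<phi> t"
    using assms(1,2) unfolding altering_distance_def by (auto intro: mono_onD)
  with assms(3) show False by simp
qed

text \<open>For \<open>a > 0\<close> the number \<open>\<phi> a\<close> is positive, so eventually
  \<open>\<phi> (d n) < \<phi> a\<close>; monotonicity then forces \<open>d n < a\<close>.\<close>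

lemma altering_distance_tendsto_0:
  assumes \<phi>: "altering_distance \<phi>" and d: "\<And>n. d n \<ge> 0"
    and lim: "(\<lambda>n. \<phi> (d n)) \<longlonglongrightarrow> 0"
  shows "d \<longlonglongrightarrow> 0"
proof (rule order_tendstoI)
  fix a :: real assume "a < 0"
  then have "a < d n" for n using d[of n] by simp
  then show "eventually (\<lambda>n. a < d n) sequentially" by simp
next
  fix a :: real assume a: "0 < a"
  then have "eventually (\<lambda>n. \<phi> (d n) < \<phi> a) sequentially"
    using altering_distance_pos[OF \<phi>] lim by (auto dest: order_tendstoD)
  then show "eventually (\<lambda>n. d n < a) sequentially"
    by eventually_elim (use a in \<open>auto intro: altering_distance_less_imp_less[OF \<phi>]\<close>)
qed

text \<open>The sequence \<open>a\<close> decreases and is bounded below, hence converges;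
  \<open>b n\<close> is squeezed between 0 and the difference \<open>a n - a (Suc n)\<close>, which
  vanishes in the limit.\<close>

lemma decrement_tendsto_0:
  fixes a b :: "nat \<Rightarrow> real"
  assumes a: "\<And>n. a n \<ge> 0" and b: "\<And>n. b n \<ge> 0" and step: "\<And>n. a (Suc n) + b n \<le> a n"
  shows "b \<longlonglongrightarrow> 0"
proof -
  have le: "a (Suc n) \<le> a n" for n using step[of n] b[of n] by simp
  obtain L where L: "a \<longlonglongrightarrow> L"
    using decseq_convergent[OF decseq_SucI[of a, OF le], of 0] a by blast
  have "(\<lambda>n. a n - a (Suc n)) \<longlonglongrightarrow> 0"
    using tendsto_diff[OF L LIMSEQ_Suc[OF L]] by simp
  then show ?thesis
    by (rule tendsto_sandwich[OF _ _ tendsto_const, rotated 2])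
       (use b step in \<open>auto simp: le_diff_eq add.commute\<close>)
qed

text \<open>The contraction only compares a value of \<open>f\<close> with a value of
  \<open>g\<close>, so it controls only indices of opposite parity. Two indices \<open>p\<close> and
  \<open>q\<close> of equal parity are compared through \<open>Suc q\<close>, which has the opposite
  parity to both; this costs a factor 2.\<close>

lemma Cauchy_alternating:
  fixes x :: "nat \<Rightarrow> 'a::metric_space"
  assumes "\<And>e. e > 0 \<Longrightarrow> \<exists>N. \<forall>p\<ge>N. \<forall>q\<ge>N. even p \<longrightarrow> odd q \<longrightarrow> dist (x p) (x q) < e"
  shows "Cauchy x"
proof (rule metric_CauchyI)
  fix e :: real assume "e > 0"
  then obtain N where N: "\<And>p q. p \<ge> N \<Longrightarrow> q \<ge> N \<Longrightarrow> even p \<Longrightarrow> odd q \<Longrightarrow> dist (x p) (x q) < e / 2"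
    using assms[of "e / 2"] by auto
  have opp: "dist (x p) (x q) < e / 2" if "p \<ge> N" "q \<ge> N" "even p \<noteq> even q" for p q
    using N[of p q] N[of q p] that by (auto simp: dist_commute)
  have "dist (x p) (x q) < e" if "p \<ge> N" "q \<ge> N" for p q
  proof (cases "even p = even q")
    case True
    then have "dist (x p) (x (Suc q)) < e / 2" "dist (x q) (x (Suc q)) < e / 2"
      using opp that by simp_all
    then show ?thesis by (rule dist_triangle_half_l)
  next
    case False
    then show ?thesis using opp[of p q] that \<open>e > 0\<close> by simp
  qed
  then show "\<exists>M. \<forall>m\<ge>M. \<forall>n\<ge>M. dist (x m) (x n) < e" by blast
qed

text \<open>The values \<open>h (x (r n))\<close> tend to \<open>h z\<close> by continuity, but they
  are also a subsequence of the shifted orbit and so tend to \<open>z\<close>.\<close>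

lemma continuous_fixed_point_subseq:
  fixes h :: "'a::t2_space \<Rightarrow> 'a" and r :: "nat \<Rightarrow> nat"
  assumes "continuous_on C h" "\<And>n. x n \<in> C" "z \<in> C" "x \<longlonglongrightarrow> z"
    and "strict_mono r" "\<And>n. x (Suc (r n)) = h (x (r n))"
  shows "h z = z"
proof -
  have "(\<lambda>n. h (x (r n))) \<longlonglongrightarrow> h z"
    using LIMSEQ_subseq_LIMSEQ[OF assms(4,5)]
    by (intro continuous_on_tendsto_compose[OF assms(1) _ assms(3)]) (simp_all add: o_def assms(2))
  moreover have "(\<lambda>n. x (Suc (r n))) \<longlonglongrightarrow> z"
    using LIMSEQ_subseq_LIMSEQ[OF LIMSEQ_Suc[OF assms(4)] assms(5)] by (simp add: o_def)
  ultimately show ?thesis unfolding assms(6) by (rule LIMSEQ_unique)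
qed

theorem theorem2p2:
  fixes C :: "'a::banach set"
    and f g :: "'a \<Rightarrow> 'a"
    and \<phi> \<phi>\<^sub>1 :: "real \<Rightarrow> real"
    and \<psi> :: "real \<times> real \<Rightarrow> real"
  assumes "C \<noteq> {}" and "closed C"
    and "f \<in> C \<rightarrow> C" and "g \<in> C \<rightarrow> C"
    and "continuous_on C f" and "continuous_on C g"
    and "altering_distance \<phi>" and "altering_distance \<phi>\<^sub>1"
    and "\<psi> \<in> {0..} \<times> {0..} \<rightarrow> {0..}"
    and "continuous (at (0, 0) within {0..} \<times> {0..}) \<psi>"
    and "\<psi> (0, 0) = 0"
    and "\<And>t\<^sub>1 t\<^sub>2. t\<^sub>1 \<ge> 0 \<Longrightarrow> t\<^sub>2 \<ge> 0 \<Longrightarrow> t\<^sub>1 > 0 \<or> t\<^sub>2 > 0 \<Longrightarrow>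
           \<psi> (t\<^sub>1, t\<^sub>2) < \<phi> t\<^sub>1 \<or> \<psi> (t\<^sub>1, t\<^sub>2) < \<phi> t\<^sub>2"
    and "\<And>x y. x \<in> C \<Longrightarrow> y \<in> C \<Longrightarrow>
           \<phi> (norm (f x - g y)) \<le> \<psi> (norm (x - f x), norm (y - g y)) - \<phi>\<^sub>1 (norm (x - y))"
  shows "\<exists>!z. z \<in> C \<and> f z = z \<and> g z = z"
proof (rule ex_ex1I)
  note contr = assms(13)
  have \<phi>_bound: "\<phi> (norm (f u - g v)) + \<phi>\<^sub>1 (norm (u - v)) \<le> \<psi> (norm (u - f u), norm (v - g v))"
    if "u \<in> C" "v \<in> C" for u v
    using contr[OF that] by simp
  have \<phi>\<^sub>1_bound: "\<phi>\<^sub>1 (norm (u - v)) \<le> \<psi> (norm (u - f u), norm (v - g v))"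
    if "u \<in> C" "v \<in> C" for u v
    using \<phi>_bound[OF that] altering_distance_nonneg[OF assms(7), of "norm (f u - g v)"] by simp
  obtain x\<^sub>0 where "x\<^sub>0 \<in> C" using assms(1) by blast
  define x where "x = rec_nat x\<^sub>0 (\<lambda>n y. if even n then f y else g y)"
  have x_even: "x (Suc n) = f (x n)" if "even n" for n using that by (simp add: x_def)
  have x_odd: "x (Suc n) = g (x n)" if "odd n" for n using that by (simp add: x_def)
  have xC: "x n \<in> C" for n
    by (induction n) (use \<open>x\<^sub>0 \<in> C\<close> assms(3,4) in \<open>auto simp: x_def\<close>)
  define d where "d n = norm (x n - x (Suc n))" for n
  have d_nonneg: "d n \<ge> 0" for n by (simp add: d_def)

  have step: "\<phi> (d (Suc n)) + \<phi>\<^sub>1 (d n) \<le> \<phi> (d n)" for n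
  \<comment> \<open>The strict bound on \<open>\<psi>\<close> is available only away from the
    origin, so two vanishing step lengths form a separate case.\<close>
  proof (cases "d n > 0 \<or> d (Suc n) > 0")
    case True
    \<comment> \<open>Here \<open>s\<close> is the value of \<open>\<psi>\<close> at the two step
      lengths. Since \<open>f\<close> has to act on the even-indexed point, the order of the
      arguments depends on the parity of \<open>n\<close>, while the resulting disjunction does
      not.\<close>
    obtain s where s: "\<phi> (d (Suc n)) + \<phi>\<^sub>1 (d n) \<le> s" "s < \<phi> (d n) \<or> s < \<phi> (d (Suc n))"
    proof (cases "even n")
      case e: True
      have "\<phi> (d (Suc n)) + \<phi>\<^sub>1 (d n) \<le> \<psi> (d n, d (Suc n))"
        using \<phi>_bound[OF xC xC, of n "Suc n"] e by (simp add: d_def x_even x_odd)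
      then show ?thesis using assms(12)[of "d n" "d (Suc n)"] d_nonneg True that by blast
    next
      case o: False
      have "\<phi> (d (Suc n)) + \<phi>\<^sub>1 (d n) \<le> \<psi> (d (Suc n), d n)"
        using \<phi>_bound[OF xC xC, of "Suc n" n] o by (simp add: d_def x_even x_odd norm_minus_commute)
      then show ?thesis using assms(12)[of "d (Suc n)" "d n"] d_nonneg True that by blast
    qed
    \<comment> \<open>As \<open>\<phi>\<^sub>1 (d n)\<close> is nonnegative,
      \<open>s < \<phi> (d (Suc n))\<close> contradicts the lower bound on \<open>s\<close>; only
      \<open>s < \<phi> (d n)\<close> survives.\<close>
    with altering_distance_nonneg[OF assms(8) d_nonneg, of n] show ?thesis by linarith
  next
    case False
    then have "d n = 0" "d (Suc n) = 0"
      using d_nonneg[of n] d_nonneg[of "Suc n"] by linarith+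
    then show ?thesis using altering_distance_0[OF assms(8)] by simp
  qed
  have d_lim: "d \<longlonglongrightarrow> 0"
  proof (rule altering_distance_tendsto_0[OF assms(8) d_nonneg])
    show "(\<lambda>n. \<phi>\<^sub>1 (d n)) \<longlonglongrightarrow> 0"
      by (rule decrement_tendsto_0[of "\<lambda>n. \<phi> (d n)"])
         (use step d_nonneg assms(7,8) in \<open>simp_all add: altering_distance_nonneg\<close>)
  qed

  have "Cauchy x"
  proof (rule Cauchy_alternating)
    fix e :: real assume e: "e > 0"
    \<comment> \<open>The tolerance \<open>\<phi>\<^sub>1 e\<close> is chosen so that monotonicity
      of \<open>\<phi>\<^sub>1\<close> later turns it into the distance bound
      \<open>e\<close>.\<close>
    obtain \<delta> where \<delta>: "\<delta> > 0"
      "\<And>t. t \<in> {0..} \<times> {0..} \<Longrightarrow> dist t (0, 0) < \<delta> \<Longrightarrow> dist (\<psi> t) 0 < \<phi>\<^sub>1 e"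
      using assms(10) altering_distance_pos[OF assms(8) e] assms(11)
      unfolding continuous_within_eps_delta by metis
    \<comment> \<open>Half of \<open>\<delta>\<close> for each coordinate, because the norm of a
      pair is at most the sum of the norms.\<close>
    obtain N where N: "\<And>n. n \<ge> N \<Longrightarrow> d n < \<delta> / 2"
      using order_tendstoD(2)[OF d_lim, of "\<delta> / 2"] \<delta>(1)
      by (auto simp: eventually_sequentially)
    have "dist (x p) (x q) < e" if pq: "p \<ge> N" "q \<ge> N" "even p" "odd q" for p q
    proof -
      have "dist (d p, d q) (0, 0) \<le> d p + d q"
        using norm_Pair_le[of "d p" "d q"] d_nonneg[of p] d_nonneg[of q]
        by (simp add: zero_prod_def[symmetric])
      then have "\<psi> (d p, d q) < \<phi>\<^sub>1 e"
        using \<delta>(2)[of "(d p, d q)"] N[of p] N[of q] pq d_nonneg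
        by (auto simp: dist_real_def)
      then have "\<phi>\<^sub>1 (norm (x p - x q)) < \<phi>\<^sub>1 e"
        using \<phi>\<^sub>1_bound[OF xC xC, of p q] pq by (simp add: d_def x_even x_odd)
      then show ?thesis
        using altering_distance_less_imp_less[OF assms(8)] e by (simp add: dist_norm)
    qed
    then show "\<exists>N. \<forall>p\<ge>N. \<forall>q\<ge>N. even p \<longrightarrow> odd q \<longrightarrow> dist (x p) (x q) < e" by blast
  qed
  then obtain z where z: "x \<longlonglongrightarrow> z" using Cauchy_convergent convergent_def by blast
  have "z \<in> C" using closed_sequentially[OF assms(2)] xC z by blast
  moreover have "f z = z"
    by (rule continuous_fixed_point_subseq[OF assms(5) xC \<open>z \<in> C\<close> z, of "\<lambda>n. 2 * n"])
       (auto simp: strict_mono_def x_even)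
  moreover have "g z = z"
    by (rule continuous_fixed_point_subseq[OF assms(6) xC \<open>z \<in> C\<close> z, of "\<lambda>n. Suc (2 * n)"])
       (auto simp: strict_mono_def x_odd)
  ultimately show "\<exists>z. z \<in> C \<and> f z = z \<and> g z = z" by blast

  fix u v assume "u \<in> C \<and> f u = u \<and> g u = u" "v \<in> C \<and> f v = v \<and> g v = v"
  \<comment> \<open>At common fixed points both arguments of \<open>\<psi>\<close> are 0.\<close>
  then have "\<phi>\<^sub>1 (norm (u - v)) \<le> 0"
    using \<phi>\<^sub>1_bound[of u v] assms(11) by simp
  then show "u = v"
    using altering_distance_pos[OF assms(8), of "norm (u - v)"] by (auto simp: not_le)
qed

end
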